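(* Let $k\ge 2$ and let $\{S_n\}_{n\ge 0}\subset \mathsf{Aut}_0(\mathbb{C}^k)$ satisfy the uniform upper-bound condition at the origin. Then there exist a sequence of positive real numbers $\{\delta_n\}_{n\ge 0}$ with $\delta_n\to 0$ as $n\to\infty$ and a number $r>0$ such that, for every sequence $\{F_n\}_{n\ge 0}\subset \mathsf{Aut}_0(\mathbb{C}^k)$ satisfying $$\|F_n(z)-S_n(z)\|<\delta_n\quad\text{for every } z\in B^k(0;r) \text{ and every } n\ge 0,$$ the basins of attraction at the origin $\Omega_{\{F_n\}}$ and $\Omega_{\{S_n\}}$ are biholomorphic.
   Context: $\mathsf{Aut}_0(\mathbb{C}^k)$ denotes the group of (holomorphic) automorphisms of $\mathbb{C}^k$ fixing the origin, and $B^k(p;r)$ is the ball of radius $r$ centered at $p$ in $\mathbb{C}^k$. For a sequence $\{F_n\}_{n\ge 0}\subset \mathsf{Aut}_0(\mathbb{C}^k)$ put $F(n)=F_n\circ\cdots\circ F_0$; the (non-autonomous) basin of attraction at the origin is $\Omega_{\{F_n\}}=\{z\in\mathbb{C}^k: F(n)(z)\to 0 \text{ as } n\to\infty\}$. A sequence $\{S_n\}\subset\mathsf{Aut}_0(\mathbb{C}^k)$ satisfies the uniform upper-bound condition at the origin if there exist $r>0$ and $0<C<1$ such that $\|S_n(z)\|\le C\|z\|$ for every $z\in B^k(0;r)$ and every $n\ge 0$. *)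

theory Defs
  imports "HOL-Analysis.Analysis"
begin

(* C^k is "complex ^ 'k" with k = CARD('k); its norm is the Euclidean norm.
   The derivative is required to be given by a complex matrix (the complex Jacobian),
   i.e. to be complex linear rather than only real linear. *)
definition holomorphic_map_on ::
    "(complex ^ 'k \<Rightarrow> complex ^ 'm) \<Rightarrow> (complex ^ 'k) set \<Rightarrow> bool" where
  "holomorphic_map_on f U \<longleftrightarrow>
     (\<forall>z\<in>U. \<exists>A :: complex ^ 'k ^ 'm. (f has_derivative (\<lambda>h. A *v h)) (at z))"

(* Since the derivatives above are full ones ("at z"), U and V have to be open for the notion
   not to depend on the values of the total functions f and inv_into U f outside U and V. *)
definition biholomorphism ::
    "(complex ^ 'k \<Rightarrow> complex ^ 'm) \<Rightarrow> (complex ^ 'k) set \<Rightarrow> (complex ^ 'm) set \<Rightarrow> bool" where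
  "biholomorphism f U V \<longleftrightarrow>
     open U \<and> open V \<and> bij_betw f U V \<and>
     holomorphic_map_on f U \<and> holomorphic_map_on (inv_into U f) V"

definition biholomorphic :: "(complex ^ 'k) set \<Rightarrow> (complex ^ 'm) set \<Rightarrow> bool" where
  "biholomorphic U V \<longleftrightarrow> (\<exists>f. biholomorphism f U V)"

definition Aut0 :: "(complex ^ 'k \<Rightarrow> complex ^ 'k) set" where
  "Aut0 = {f. biholomorphism f UNIV UNIV \<and> f 0 = 0}"

primrec iter_comp :: "(nat \<Rightarrow> 'a \<Rightarrow> 'a) \<Rightarrow> nat \<Rightarrow> 'a \<Rightarrow> 'a" where
  "iter_comp F 0 = F 0"
| "iter_comp F (Suc n) = F (Suc n) \<circ> iter_comp F n"

definition basin :: "(nat \<Rightarrow> complex ^ 'k \<Rightarrow> complex ^ 'k) \<Rightarrow> (complex ^ 'k) set" where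
  "basin F = {z. (\<lambda>n. iter_comp F n z) \<longlonglongrightarrow> 0}"

definition uniform_upper_bound :: "(nat \<Rightarrow> complex ^ 'k \<Rightarrow> complex ^ 'k) \<Rightarrow> bool" where
  "uniform_upper_bound S \<longleftrightarrow>
     (\<exists>r C. r > 0 \<and> 0 < C \<and> C < 1 \<and> (\<forall>n. \<forall>z\<in>ball 0 r. norm (S n z) \<le> C * norm z))"

end

theory Submission
  imports Defs "HOL-Complex_Analysis.Complex_Analysis"
begin

text \<open>
  Write \<open>S(n)\<close> and \<open>F(n)\<close> for the iterates and let \<open>R\<close> be the radius of the contraction bound.
  The maps \<open>\<psi>\<^sub>m = S(m)\<^sup>-\<^sup>1 \<circ> F(m)\<close> involve the inverses of the \<open>S\<close>-iterates only, so \<open>\<delta>\<^sub>m\<close> can be taken from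
  moduli of continuity depending on \<open>S\<close> alone, namely those of \<open>S(n) \<circ> S(m)\<^sup>-\<^sup>1\<close>, \<open>n \<le> m\<close>, on a compact ball.
  With this choice \<open>S(n) \<circ> \<psi>\<^sub>m \<circ> F(n)\<^sup>-\<^sup>1\<close> converges uniformly on \<open>B(0;R)\<close> as \<open>m \<rightarrow> \<infinity>\<close>, for every \<open>n\<close>, to a
  map within \<open>R/8\<close> of the identity. By the Cauchy estimate the limit is biholomorphic on \<open>B(0;R/2)\<close>,
  and by Brouwer its image contains \<open>B(0;R/8)\<close>. Since both basins are exhausted by preimages of these
  balls, \<open>\<psi> = lim \<psi>\<^sub>m\<close> is a biholomorphism between them.
\<close>

section \<open>Complex scalars and the Hermitian pairing\<close>

lemma norm_vector_scalar_mult_complex: "norm (t *s h) = norm t * norm (h :: complex ^ 'k)"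
  by (simp add: norm_vec_def L2_set_right_distrib norm_mult)

lemma bounded_linear_vector_scalar_mult_complex:
  "bounded_linear (\<lambda>t. t *s (h :: complex ^ 'k))"
proof (rule bounded_linear_intro)
  show "norm (t *s h) \<le> norm t * norm h" for t
    by (simp add: norm_vector_scalar_mult_complex)
qed (auto simp: vec_eq_iff algebra_simps)

text \<open>Cauchy-Schwarz for the Hermitian pairing, reduced to the real inequality for the moduli
  of the entries. Pairing with a fixed vector later turns a vector-valued map into a scalar
  one.\<close>

lemma norm_sum_cnj_mult_le:
  fixes u w :: "complex ^ 'm"
  shows "norm (\<Sum>i\<in>UNIV. cnj (u $ i) * w $ i) \<le> norm u * norm w"
proof -
  have "norm (\<Sum>i\<in>UNIV. cnj (u $ i) * w $ i) \<le> (\<Sum>i\<in>UNIV. \<bar>norm (u $ i)\<bar> * \<bar>norm (w $ i)\<bar>)"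
    by (rule sum_norm_le) (simp add: norm_mult)
  also have "\<dots> \<le> norm u * norm w"
    unfolding norm_vec_def by (rule L2_set_mult_ineq)
  finally show ?thesis .
qed

lemma sum_cnj_mult_self:
  fixes u :: "complex ^ 'm"
  shows "(\<Sum>i\<in>UNIV. cnj (u $ i) * u $ i) = of_real ((norm u)\<^sup>2)"
proof -
  have "(norm u)\<^sup>2 = (\<Sum>i\<in>UNIV. (norm (u $ i))\<^sup>2)"
    by (simp add: norm_vec_def L2_set_def sum_nonneg)
  then show ?thesis
    by (simp add: complex_norm_square[symmetric] mult.commute flip: of_real_power)
qed

section \<open>Calculus of holomorphic maps and the Cauchy estimate\<close>

lemma holomorphic_map_on_imp_continuous_on:
  "holomorphic_map_on f U \<Longrightarrow> continuous_on U f"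
  unfolding holomorphic_map_on_def
  by (meson continuous_at_imp_continuous_on has_derivative_continuous)

lemma holomorphic_map_on_subset:
  "holomorphic_map_on f U \<Longrightarrow> V \<subseteq> U \<Longrightarrow> holomorphic_map_on f V"
  unfolding holomorphic_map_on_def by blast

text \<open>Openness of \<open>U\<close> turns agreement on \<open>U\<close> into agreement near
  each of its points, so full derivatives carry over. This is how different expressions for an
  \<open>inv_into\<close> are exchanged later.\<close>

lemma holomorphic_map_on_cong:
  assumes "open U" "\<And>x. x \<in> U \<Longrightarrow> f x = g x" "holomorphic_map_on f U"
  shows "holomorphic_map_on g U"
  using assms unfolding holomorphic_map_on_def
  by (metis has_derivative_transform_within_open)

lemma holomorphic_map_on_compose:
  assumes "holomorphic_map_on f U" "holomorphic_map_on g V" "f ` U \<subseteq> V"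
  shows "holomorphic_map_on (g \<circ> f) U"
  unfolding holomorphic_map_on_def
proof
  fix z assume z: "z \<in> U"
  obtain A where A: "(f has_derivative (\<lambda>h. A *v h)) (at z)"
    using assms z unfolding holomorphic_map_on_def by blast
  obtain B where B: "(g has_derivative (\<lambda>h. B *v h)) (at (f z))"
    using assms z unfolding holomorphic_map_on_def by blast
  have "(g \<circ> f has_derivative (\<lambda>h. (B ** A) *v h)) (at z)"
    using diff_chain_at[OF A B] by (simp add: o_def matrix_vector_mul_assoc)
  then show "\<exists>A. (g \<circ> f has_derivative (\<lambda>h. A *v h)) (at z)" by blast
qed

lemma holomorphic_map_on_diff:
  assumes "holomorphic_map_on f U" "holomorphic_map_on g U"
  shows "holomorphic_map_on (\<lambda>z. f z - g z) U"
  unfolding holomorphic_map_on_def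
proof
  fix z assume z: "z \<in> U"
  obtain A B where "(f has_derivative (\<lambda>h. A *v h)) (at z)" "(g has_derivative (\<lambda>h. B *v h)) (at z)"
    using assms z unfolding holomorphic_map_on_def by blast
  then have "((\<lambda>z. f z - g z) has_derivative (\<lambda>h. (A - B) *v h)) (at z)"
    using has_derivative_diff by (fastforce simp: matrix_vector_mult_diff_rdistrib)
  then show "\<exists>A. ((\<lambda>z. f z - g z) has_derivative (\<lambda>h. A *v h)) (at z)" by blast
qed

lemma holomorphic_map_on_ident: "holomorphic_map_on (\<lambda>z. z) U"
  unfolding holomorphic_map_on_def
  by (intro ballI exI[of _ "mat 1"]) (simp add: matrix_vector_mul_lid[abs_def])

text \<open>One-variable Cauchy estimate for \<open>t \<mapsto> \<langle>f (x + t h), A h\<rangle>\<close>.\<close>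

lemma holomorphic_map_Cauchy_estimate:
  fixes f :: "complex ^ 'k \<Rightarrow> complex ^ 'm"
  assumes hol: "holomorphic_map_on f U" and sub: "cball x \<rho> \<subseteq> U" and "\<rho> > 0"
    and bd: "\<And>y. y \<in> cball x \<rho> \<Longrightarrow> norm (f y) \<le> M"
    and der: "(f has_derivative (\<lambda>h. A *v h)) (at x)"
  shows "norm (A *v h) \<le> M / \<rho> * norm h"
proof (cases "h = 0 \<or> A *v h = 0")
  case True
  \<comment> \<open>In the degenerate case only \<open>0 \<le> M\<close> is at stake, and the bound
    at the centre gives it.\<close>
  have "0 \<le> norm (f x)" by simp
  also have "\<dots> \<le> M" using bd[of x] \<open>\<rho> > 0\<close> by simp
  finally show ?thesis using True \<open>\<rho> > 0\<close> by auto
next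
  case False
  \<comment> \<open>Pairing with \<open>u\<close> itself makes the derivative of \<open>g\<close> at
    0 equal to the square of \<open>norm u\<close>, while \<open>g\<close> is bounded by
    \<open>norm u * M\<close>. The radius \<open>s\<close> is the largest for which the disc of all
    \<open>t\<close> is sent into \<open>cball x \<rho>\<close>. The one-variable inequality then
    yields the claim after cancelling one factor \<open>norm u\<close>.\<close>
  define u where "u = A *v h"
  define s where "s = \<rho> / norm h"
  have nz: "norm h > 0" "norm u > 0" "s > 0"
    using False \<open>\<rho> > 0\<close> by (auto simp: u_def s_def)
  define \<phi> where "\<phi> w = (\<Sum>i\<in>UNIV. cnj (u $ i) * w $ i)" for w :: "complex ^ 'm"
  define g where "g t = \<phi> (f (x + t *s h))" for t :: complex
  have \<phi>: "bounded_linear \<phi>"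
  proof (rule bounded_linear_intro)
    show "norm (\<phi> w) \<le> norm w * norm u" for w
      unfolding \<phi>_def using norm_sum_cnj_mult_le[of u w] by (simp add: mult.commute)
  qed (auto simp: \<phi>_def algebra_simps sum.distrib scaleR_sum_right)
  have \<phi>_scale: "\<phi> (t *s w) = \<phi> w * t" for t w
    by (simp add: \<phi>_def sum_distrib_left sum_distrib_right mult_ac)
  have in_ball: "x + t *s h \<in> cball x \<rho>" if "norm t \<le> s" for t
    using that nz by (simp add: dist_norm norm_vector_scalar_mult_complex s_def field_simps)
  have gder: "(g has_field_derivative \<phi> (B *v h)) (at t)"
    if "(f has_derivative (\<lambda>h. B *v h)) (at (x + t *s h))" for t B
  proof -
    have 1: "((\<lambda>t. x + t *s h) has_derivative (\<lambda>t. t *s h)) (at t)"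
      using bounded_linear_imp_has_derivative[OF bounded_linear_vector_scalar_mult_complex]
      by (auto intro!: derivative_eq_intros)
    have "((\<lambda>t. f (x + t *s h)) has_derivative (\<lambda>t. B *v (t *s h))) (at t)"
      using diff_chain_at[OF 1 that] by (simp add: o_def)
    then have "((\<lambda>t. \<phi> (f (x + t *s h))) has_derivative (\<lambda>t. \<phi> (B *v (t *s h)))) (at t)"
      by (rule bounded_linear.has_derivative[OF \<phi>])
    then show ?thesis
      unfolding g_def has_field_derivative_def
      by (simp add: vector_scalar_commute \<phi>_scale)
  qed
  have gdiff: "\<exists>D. (g has_field_derivative D) (at t)" if "norm t \<le> s" for t
    using gder in_ball[OF that] sub hol unfolding holomorphic_map_on_def by blast
  have "norm ((deriv ^^ 1) g 0) \<le> fact 1 * (norm u * M) / s ^ 1"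
  proof (rule Cauchy_inequality)
    show "g holomorphic_on ball 0 s"
      using gdiff by (auto simp: holomorphic_on_open)
    show "continuous_on (cball 0 s) g"
      by (rule continuous_at_imp_continuous_on) (use gdiff DERIV_isCont in fastforce)
    show "norm (g t) \<le> norm u * M" if "norm (0 - t) = s" for t
    proof -
      have "norm (g t) \<le> norm u * norm (f (x + t *s h))"
        unfolding g_def \<phi>_def by (rule norm_sum_cnj_mult_le)
      also have "\<dots> \<le> norm u * M"
        using that by (intro mult_left_mono bd in_ball) auto
      finally show ?thesis .
    qed
  qed fact
  moreover have "deriv g 0 = \<phi> u"
    using gder[of A 0] der by (auto simp: u_def intro!: DERIV_imp_deriv)
  moreover have "norm (\<phi> u) = norm u * norm u"
    by (simp add: \<phi>_def sum_cnj_mult_self norm_power power2_eq_square norm_mult)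
  ultimately have "norm u * norm u \<le> norm u * (M / s)"
    by simp
  then have "norm u \<le> M / s"
    using nz(2) by (simp only: mult_le_cancel_left_pos)
  then show ?thesis by (simp add: u_def s_def)
qed

section \<open>Uniform limits of holomorphic maps\<close>

text \<open>Complex linearity survives pointwise limits, and a complex linear map is a matrix. This
  ensures that a limit of complex Jacobians is again one.\<close>

lemma vec_linear_limit:
  fixes A :: "nat \<Rightarrow> complex ^ 'k ^ 'm"
  assumes "\<And>h. (\<lambda>n. A n *v h) \<longlonglongrightarrow> G h"
  shows "\<exists>B. G = (\<lambda>h. B *v h)"
proof -
  have "Vector_Spaces.linear (*s) (*s) G"
  proof unfold_locales
    fix b1 b2 :: "complex ^ 'k" and r :: complex
    have "(\<lambda>n. A n *v (b1 + b2)) \<longlonglongrightarrow> G b1 + G b2"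
      unfolding matrix_vector_right_distrib by (intro tendsto_add assms)
    then show "G (b1 + b2) = G b1 + G b2" using assms LIMSEQ_unique by blast
    have "(\<lambda>n. A n *v (r *s b1)) \<longlonglongrightarrow> r *s G b1"
      unfolding vector_scalar_commute
      by (intro vec_tendstoI) (auto intro!: tendsto_mult_left tendsto_vec_nth assms)
    then show "G (r *s b1) = r *s G b1" using assms LIMSEQ_unique by blast
  qed
  then show ?thesis by (metis matrix_works ext)
qed

text \<open>Weierstrass's theorem: the Cauchy estimate applied to differences
  \<open>f m - f n\<close> makes the derivatives uniformly Cauchy on a smaller ball, after which the
  real theorem on differentiating a sequence term by term applies.\<close>

lemma holomorphic_map_uniform_limit:
  fixes f :: "nat \<Rightarrow> complex ^ 'k \<Rightarrow> complex ^ 'm"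
  assumes hol: "\<And>n. holomorphic_map_on (f n) (ball a R)"
    and lim: "uniform_limit (ball a R) f g sequentially"
  shows "holomorphic_map_on g (ball a R)"
  unfolding holomorphic_map_on_def
proof
  fix z assume z: "z \<in> ball a R"
  obtain \<rho> where "\<rho> > 0" and "ball z \<rho> \<subseteq> ball a R"
    using z open_ball open_contains_ball_eq by blast
  \<comment> \<open>One third leaves room for a closed ball of radius \<open>d\<close> around every
    point of \<open>ball z d\<close>, so the Cauchy estimate holds there with one common
    radius.\<close>
  define d where "d = \<rho> / 3"
  have "d > 0" using \<open>\<rho> > 0\<close> by (simp add: d_def)
  have sub: "cball x d \<subseteq> ball a R" if "x \<in> ball z d" for x
  proof
    fix y assume "y \<in> cball x d"
    then have "dist z y < \<rho>"
      using that dist_triangle[of z y x] \<open>\<rho> > 0\<close> by (auto simp: d_def)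
    then show "y \<in> ball a R" using \<open>ball z \<rho> \<subseteq> ball a R\<close> by auto
  qed
  have sub': "x \<in> ball a R" if "x \<in> ball z d" for x
    using subsetD[OF sub[OF that], of x] \<open>d > 0\<close> by simp
  have "\<forall>n x. \<exists>A. x \<in> ball a R \<longrightarrow> (f n has_derivative (\<lambda>h. A *v h)) (at x)"
    using hol unfolding holomorphic_map_on_def by blast
  then obtain A where A: "\<And>n x. x \<in> ball a R \<Longrightarrow> (f n has_derivative (\<lambda>h. A n x *v h)) (at x)"
    by metis
  have Cau: "\<exists>N. \<forall>m\<ge>N. \<forall>n\<ge>N. \<forall>x\<in>ball z d. \<forall>h. norm (A m x *v h - A n x *v h) \<le> e * norm h"
    if "e > 0" for e
  proof -
    have "uniformly_Cauchy_on (ball a R) f"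
      using lim uniformly_convergent_Cauchy uniformly_convergent_on_def by blast
    then obtain N where N: "\<And>x m n. x \<in> ball a R \<Longrightarrow> m \<ge> N \<Longrightarrow> n \<ge> N \<Longrightarrow> dist (f m x) (f n x) < e * d"
      using \<open>e > 0\<close> \<open>d > 0\<close> unfolding uniformly_Cauchy_on_def by (meson mult_pos_pos)
    have "norm (A m x *v h - A n x *v h) \<le> e * norm h"
      if "m \<ge> N" "n \<ge> N" "x \<in> ball z d" for m n x h
    proof -
      \<comment> \<open>The values are within \<open>e * d\<close> of each other; the Cauchy
        estimate on radius \<open>d\<close> divides by \<open>d\<close>.\<close>
      have "norm ((A m x - A n x) *v h) \<le> (e * d) / d * norm h"
      proof (rule holomorphic_map_Cauchy_estimate)
        show "holomorphic_map_on (\<lambda>y. f m y - f n y) (ball a R)"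
          by (intro holomorphic_map_on_diff hol)
        show "norm (f m y - f n y) \<le> e * d" if "y \<in> cball x d" for y
          using N[of y m n] sub[OF \<open>x \<in> ball z d\<close>] that \<open>m \<ge> N\<close> \<open>n \<ge> N\<close>
          by (force simp: dist_norm)
        show "((\<lambda>y. f m y - f n y) has_derivative (\<lambda>h. (A m x - A n x) *v h)) (at x)"
          unfolding matrix_vector_mult_diff_rdistrib
          using sub'[OF \<open>x \<in> ball z d\<close>] by (intro has_derivative_diff A)
      qed (use sub[OF \<open>x \<in> ball z d\<close>] \<open>d > 0\<close> in auto)
      then show ?thesis using \<open>d > 0\<close> by (simp add: matrix_vector_mult_diff_rdistrib)
    qed
    then show ?thesis by blast
  qed
  define G where "G x h = lim (\<lambda>n. A n x *v h)" for x h
  have G: "(\<lambda>n. A n x *v h) \<longlonglongrightarrow> G x h" if x: "x \<in> ball z d" for x h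
  proof -
    have "Cauchy (\<lambda>n. A n x *v h)"
    proof (rule metric_CauchyI)
      fix e :: real assume "e > 0"
      \<comment> \<open>Adding 1 to \<open>norm h\<close> covers \<open>h = 0\<close> and makes the
        final inequality strict.\<close>
      then have "e / (norm h + 1) > 0" by (simp add: add_nonneg_pos)
      then obtain N where N: "\<forall>m\<ge>N. \<forall>n\<ge>N. norm (A m x *v h - A n x *v h) \<le> e / (norm h + 1) * norm h"
        using Cau[of "e / (norm h + 1)"] x by blast
      have "e / (norm h + 1) * norm h < e"
        using \<open>e > 0\<close> by (simp add: divide_simps add_nonneg_pos) 
      then show "\<exists>M. \<forall>m\<ge>M. \<forall>n\<ge>M. dist (A m x *v h) (A n x *v h) < e"
        using N unfolding dist_norm by (meson le_less_trans)
    qed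
    then show ?thesis
      unfolding G_def by (simp add: Cauchy_convergent convergent_LIMSEQ_iff[symmetric])
  qed
  have "\<exists>g'. \<forall>x\<in>ball z d. (\<lambda>n. f n x) \<longlonglongrightarrow> g' x \<and> (g' has_derivative G x) (at x within ball z d)"
  proof (rule has_derivative_sequence)
    show "(f n has_derivative (\<lambda>h. A n x *v h)) (at x within ball z d)" if "x \<in> ball z d" for n x
      using A sub'[OF that] has_derivative_at_withinI by blast
    show "\<forall>\<^sub>F n in sequentially. \<forall>x\<in>ball z d. \<forall>h. norm (A n x *v h - G x h) \<le> e * norm h"
      if "e > 0" for e
    proof -
      obtain N where N: "\<forall>m\<ge>N. \<forall>n\<ge>N. \<forall>x\<in>ball z d. \<forall>h. norm (A m x *v h - A n x *v h) \<le> e * norm h"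
        using Cau[OF \<open>e > 0\<close>] by blast
      have "norm (A m x *v h - G x h) \<le> e * norm h" if "m \<ge> N" "x \<in> ball z d" for m x h
      proof (rule tendsto_le[OF trivial_limit_sequentially tendsto_const])
        show "(\<lambda>n. norm (A m x *v h - A n x *v h)) \<longlonglongrightarrow> norm (A m x *v h - G x h)"
          by (intro tendsto_intros G that)
        show "\<forall>\<^sub>F n in sequentially. norm (A m x *v h - A n x *v h) \<le> e * norm h"
          unfolding eventually_sequentially using N that by blast
      qed
      then show ?thesis unfolding eventually_sequentially by blast
    qed
    show "z \<in> ball z d" using \<open>d > 0\<close> by simp
    show "(\<lambda>n. f n z) \<longlonglongrightarrow> g z" using lim z by (rule tendsto_uniform_limitI)
  qed simp
  then obtain g' where g': "\<And>x. x \<in> ball z d \<Longrightarrow> (\<lambda>n. f n x) \<longlonglongrightarrow> g' x"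
      "\<And>x. x \<in> ball z d \<Longrightarrow> (g' has_derivative G x) (at x within ball z d)"
    by blast
  have eq: "g' x = g x" if "x \<in> ball z d" for x
    using g'(1)[OF that] tendsto_uniform_limitI[OF lim sub'[OF that]] LIMSEQ_unique by blast
  have zd: "z \<in> ball z d" using \<open>d > 0\<close> by simp
  have "(g' has_derivative G z) (at z)"
    using g'(2)[OF zd] at_within_open[OF zd open_ball] by simp
  then have "(g has_derivative G z) (at z)"
    by (rule has_derivative_transform_within_open[OF _ open_ball zd eq])
  moreover obtain B where "G z = (\<lambda>h. B *v h)"
    using vec_linear_limit[of "\<lambda>n. A n z" "G z"] G[OF zd] by blast
  ultimately show "\<exists>B. (g has_derivative (\<lambda>h. B *v h)) (at z)" by auto
qed

section \<open>Local inversion and maps close to the identity\<close>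

text \<open>An injective square Jacobian has a two-sided inverse matrix, which the inverse function
  theorem gives as the derivative of the inverse map. The image is open by invariance of
  domain.\<close>

lemma biholomorphism_image_open:
  fixes f :: "complex ^ 'k \<Rightarrow> complex ^ 'k"
  assumes "open U" "inj_on f U" "holomorphic_map_on f U"
    and inj: "\<And>z A v. z \<in> U \<Longrightarrow> (f has_derivative (\<lambda>h. A *v h)) (at z) \<Longrightarrow> A *v v = 0 \<Longrightarrow> v = 0"
  shows "biholomorphism f U (f ` U)"
proof -
  have cont: "continuous_on U f" using assms by (simp add: holomorphic_map_on_imp_continuous_on)
  have "\<exists>B. (inv_into U f has_derivative (\<lambda>h. B *v h)) (at (f z))" if z: "z \<in> U" for z
  proof -
    obtain A where A: "(f has_derivative (\<lambda>h. A *v h)) (at z)"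
      using assms(3) z unfolding holomorphic_map_on_def by blast
    have "inj ((*v) A)"
    proof (rule injI)
      fix v w assume "A *v v = A *v w"
      then have "A *v (v - w) = 0" by (simp add: matrix_vector_mult_diff_distrib)
      then show "v = w" using inj[OF z A, of "v - w"] by simp
    qed
    then obtain B where "B ** A = mat 1" using matrix_left_invertible_injective by blast
    then have "A ** B = mat 1" by (simp add: matrix_left_right_inverse)
    then have "(\<lambda>h. A *v h) \<circ> (\<lambda>h. B *v h) = id"
      by (auto simp: fun_eq_iff matrix_vector_mul_assoc)
    then have "(inv_into U f has_derivative (\<lambda>h. B *v h)) (at (f z))"
      using assms(2) by (intro has_derivative_inverse_strong[OF \<open>open U\<close> z cont _ A]) simp_all
    then show ?thesis by blast
  qed
  then show ?thesis
    unfolding biholomorphism_def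
    using assms(1-3) cont invariance_of_domain
    by (auto simp: holomorphic_map_on_def bij_betw_def)
qed

text \<open>Points of the half ball have room for radius \<open>R / 4\<close>, so the Cauchy
  estimate bounds the derivative of \<open>H - id\<close> by
  \<open>(R / 8) / (R / 4) = 1 / 2\<close>. Hence \<open>H\<close> is injective with injective
  derivative.\<close>

lemma near_identity_biholomorphism:
  fixes H :: "complex ^ 'k \<Rightarrow> complex ^ 'k"
  assumes "R > 0" and hol: "holomorphic_map_on H (ball 0 R)"
    and near: "\<And>w. w \<in> ball 0 R \<Longrightarrow> norm (H w - w) \<le> R / 8"
  shows "biholomorphism H (ball 0 (R / 2)) (H ` ball 0 (R / 2))"
    and "ball 0 (R / 8) \<subseteq> H ` ball 0 (R / 2)"
proof -
  have sub: "cball x (R / 4) \<subseteq> ball 0 R" if "x \<in> ball 0 (R / 2)" for x :: "complex ^ 'k"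
  proof
    fix y assume "y \<in> cball x (R / 4)"
    then have "dist 0 y < R" using that dist_triangle[of 0 y x] \<open>R > 0\<close> by auto
    then show "y \<in> ball 0 R" by simp
  qed
  have est: "norm (A *v h - h) \<le> 1 / 2 * norm h"
    if "x \<in> ball 0 (R / 2)" "(H has_derivative (\<lambda>h. A *v h)) (at x)" for x A h
  proof -
    have "norm ((A - mat 1) *v h) \<le> (R / 8) / (R / 4) * norm h"
    proof (rule holomorphic_map_Cauchy_estimate)
      show "holomorphic_map_on (\<lambda>y. H y - y) (ball 0 R)"
        by (intro holomorphic_map_on_diff hol holomorphic_map_on_ident)
      show "((\<lambda>y. H y - y) has_derivative (\<lambda>h. (A - mat 1) *v h)) (at x)"
        unfolding matrix_vector_mult_diff_rdistrib matrix_vector_mul_lid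
        using that by (intro has_derivative_diff has_derivative_ident)
    qed (use sub[OF that(1)] near \<open>R > 0\<close> in auto)
    then show ?thesis using \<open>R > 0\<close> by (simp add: matrix_vector_mult_diff_rdistrib)
  qed
  \<comment> \<open>Mean value inequality on the convex half ball, with \<open>est\<close> as bound
    for the derivative.\<close>
  have lip: "norm ((H x - x) - (H y - y)) \<le> 1 / 2 * norm (x - y)"
    if "x \<in> ball 0 (R / 2)" "y \<in> ball 0 (R / 2)" for x y
  proof -
    have "\<forall>x. \<exists>A. x \<in> ball 0 R \<longrightarrow> (H has_derivative (\<lambda>h. A *v h)) (at x)"
      using hol unfolding holomorphic_map_on_def by blast
    then obtain A where A: "\<And>x. x \<in> ball 0 R \<Longrightarrow> (H has_derivative (\<lambda>h. A x *v h)) (at x)"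
      by metis
    show ?thesis
    proof (rule differentiable_bound[OF convex_ball _ _ that])
      fix x :: "complex ^ 'k" assume x: "x \<in> ball 0 (R / 2)"
      then have H: "(H has_derivative (\<lambda>h. A x *v h)) (at x)"
        using A \<open>R > 0\<close> by simp
      then show "((\<lambda>x. H x - x) has_derivative (\<lambda>h. A x *v h - h)) (at x within ball 0 (R / 2))"
        by (intro has_derivative_at_withinI[OF has_derivative_diff] has_derivative_ident)
      show "onorm (\<lambda>h. A x *v h - h) \<le> 1 / 2"
        using est[OF x H] by (intro onorm_le)
    qed
  qed
  show "biholomorphism H (ball 0 (R / 2)) (H ` ball 0 (R / 2))"
  proof (rule biholomorphism_image_open)
    show "inj_on H (ball 0 (R / 2))"
    proof (rule inj_onI)
      fix x y assume "x \<in> ball 0 (R / 2)" "y \<in> ball 0 (R / 2)" "H x = H y"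
      with lip[of x y] have "norm (y - x) \<le> 1 / 2 * norm (x - y)" by simp
      then show "x = y" by (simp add: norm_minus_commute)
    qed
    show "holomorphic_map_on H (ball 0 (R / 2))"
      using hol \<open>R > 0\<close> by (auto intro: holomorphic_map_on_subset)
    show "v = 0" if "z \<in> ball 0 (R / 2)" "(H has_derivative (\<lambda>h. A *v h)) (at z)" "A *v v = 0" for z A v
      using est[OF that(1,2), of v] that(3) by simp
  qed simp
  show "ball 0 (R / 8) \<subseteq> H ` ball 0 (R / 2)"
  proof
    fix y :: "complex ^ 'k" assume y: "y \<in> ball 0 (R / 8)"
    \<comment> \<open>Solutions of \<open>H x = y\<close> are fixed points of \<open>w\<close>
      mapped to \<open>y + (w - H w)\<close>. This map sends \<open>cball 0 (R / 4)\<close> into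
      itself because \<open>R / 8 + R / 8 = R / 4\<close>.\<close>
    have "\<exists>x\<in>cball 0 (R / 4). H x = y"
    proof (rule brouwer_surjective_cball)
      show "continuous_on (cball 0 (R / 4)) H"
        using holomorphic_map_on_imp_continuous_on[OF hol] \<open>R > 0\<close>
        by (auto intro: continuous_on_subset)
      show "v + (w - H w) \<in> cball 0 (R / 4)" if "v \<in> {y}" "w \<in> cball 0 (R / 4)" for v w
        using near[of w] norm_triangle_ineq[of v "w - H w"] that y \<open>R > 0\<close>
        by (simp add: norm_minus_commute)
    qed (use \<open>R > 0\<close> in auto)
    then obtain x where "x \<in> cball 0 (R / 4)" "H x = y" by blast
    then show "y \<in> H ` ball 0 (R / 2)" using \<open>R > 0\<close> by (intro image_eqI[of _ _ x]) auto
  qed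
qed

section \<open>Composing, restricting and gluing biholomorphisms\<close>

lemma biholomorphism_compose:
  assumes f: "biholomorphism f U V" and g: "biholomorphism g V W"
  shows "biholomorphism (g \<circ> f) U W"
  unfolding biholomorphism_def
proof (intro conjI)
  have fU: "f ` U = V" "inj_on f U" and gV: "g ` V = W" "inj_on g V"
    using f g unfolding biholomorphism_def bij_betw_def by auto
  show "open U" "open W"
    using f g unfolding biholomorphism_def by auto
  show "bij_betw (g \<circ> f) U W"
    using f g unfolding biholomorphism_def by (blast intro: bij_betw_trans)
  show "holomorphic_map_on (g \<circ> f) U"
    using f g fU unfolding biholomorphism_def by (blast intro: holomorphic_map_on_compose)
  have "holomorphic_map_on (inv_into U f \<circ> inv_into V g) W"
    using f g gV unfolding biholomorphism_def
    by (auto intro!: holomorphic_map_on_compose simp: inv_into_into)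
  moreover have "(inv_into U f \<circ> inv_into V g) y = inv_into U (g \<circ> f) y" if "y \<in> W" for y
    using fU gV that by (simp add: inv_into_comp)
  ultimately show "holomorphic_map_on (inv_into U (g \<circ> f)) W"
    using \<open>open W\<close> holomorphic_map_on_cong by blast
qed

lemma biholomorphism_restrict:
  fixes f :: "complex ^ 'k \<Rightarrow> complex ^ 'k"
  assumes f: "biholomorphism f U V" and "open W" "W \<subseteq> U"
  shows "biholomorphism f W (f ` W)"
  unfolding biholomorphism_def
proof (intro conjI)
  have inj: "inj_on f U" "inj_on f W"
    using f \<open>W \<subseteq> U\<close> unfolding biholomorphism_def bij_betw_def by (auto intro: inj_on_subset)
  show hol: "holomorphic_map_on f W"
    using f \<open>W \<subseteq> U\<close> unfolding biholomorphism_def by (blast intro: holomorphic_map_on_subset)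
  show op: "open (f ` W)"
    using holomorphic_map_on_imp_continuous_on[OF hol] \<open>open W\<close> inj(2) by (rule invariance_of_domain)
  show "bij_betw f W (f ` W)" using inj by (simp add: bij_betw_def)
  have "holomorphic_map_on (inv_into U f) (f ` W)"
    using f \<open>W \<subseteq> U\<close> unfolding biholomorphism_def bij_betw_def
    by (blast intro: holomorphic_map_on_subset)
  moreover have "inv_into U f y = inv_into W f y" if "y \<in> f ` W" for y
    using inj \<open>W \<subseteq> U\<close> that by auto
  ultimately show "holomorphic_map_on (inv_into W f) (f ` W)"
    using op holomorphic_map_on_cong by blast
qed fact

lemma biholomorphism_inv:
  assumes "biholomorphism f UNIV UNIV"
  shows "biholomorphism (inv f) UNIV UNIV"
  using assms unfolding biholomorphism_def
  by (simp add: bij_imp_bij_inv inv_inv_eq)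

lemma biholomorphism_Union:
  assumes bih: "\<And>i. biholomorphism f (W i) (f ` W i)"
    and dir: "\<And>x y. x \<in> (\<Union>i. W i) \<Longrightarrow> y \<in> (\<Union>i. W i) \<Longrightarrow> \<exists>i. x \<in> W i \<and> y \<in> W i"
  shows "biholomorphism f (\<Union>i. W i) (f ` (\<Union>i. W i))"
  unfolding biholomorphism_def
proof (intro conjI)
  have W: "open (W i)" "open (f ` W i)" "inj_on f (W i)" "holomorphic_map_on f (W i)"
    "holomorphic_map_on (inv_into (W i) f) (f ` W i)" for i
    using bih[of i] by (auto simp: biholomorphism_def bij_betw_def)
  show "open (\<Union>i. W i)" using W by blast
  show "open (f ` (\<Union>i. W i))" unfolding image_UN using W by blast
  have inj: "inj_on f (\<Union>i. W i)"
    by (rule inj_onI) (metis dir W(3) inj_onD)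
  then show "bij_betw f (\<Union>i. W i) (f ` (\<Union>i. W i))" by (simp add: bij_betw_def)
  show "holomorphic_map_on f (\<Union>i. W i)" using W(4) unfolding holomorphic_map_on_def by blast
  have "holomorphic_map_on (inv_into (\<Union>i. W i) f) (f ` W i)" for i
  proof (rule holomorphic_map_on_cong[OF W(2) _ W(5)])
    fix y assume "y \<in> f ` W i"
    then show "inv_into (W i) f y = inv_into (\<Union>i. W i) f y"
      using inj W(3)[of i] by (metis UN_I UNIV_I imageE inv_into_f_f)
  qed
  then show "holomorphic_map_on (inv_into (\<Union>i. W i) f) (f ` (\<Union>i. W i))"
    unfolding holomorphic_map_on_def by blast
qed

section \<open>The limit biholomorphism between the attracted sets\<close>

text \<open>The families \<open>f\<close> and \<open>s\<close> stand for the iterates; how these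
  arise matters only through the assumptions on them. By \<open>close\<close>, the maps
  \<open>inv (s m) \<circ> f m\<close>, seen through \<open>s n\<close>, have increments dominated
  by a geometric series of total at most \<open>R / 8\<close>, the tolerance for maps near the
  identity.\<close>

lemma biholomorphic_attracted_sets:
  fixes f s :: "nat \<Rightarrow> complex ^ 'k \<Rightarrow> complex ^ 'k"
  assumes f: "\<And>n. biholomorphism (f n) UNIV UNIV"
    and s: "\<And>n. biholomorphism (s n) UNIV UNIV"
    and "R > 0"
    and f_step: "\<And>n z. f n z \<in> ball 0 R \<Longrightarrow> f (Suc n) z \<in> ball 0 R"
    and f_attr: "\<And>n z. f n z \<in> ball 0 R \<Longrightarrow> (\<lambda>m. f m z) \<longlonglongrightarrow> 0"
    and s_attr: "\<And>n z. s n z \<in> ball 0 R \<Longrightarrow> (\<lambda>m. s m z) \<longlonglongrightarrow> 0"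
    and close: "\<And>n m z. n \<le> m \<Longrightarrow> f m z \<in> ball 0 R \<Longrightarrow>
      norm (s n (inv (s (Suc m)) (f (Suc m) z)) - s n (inv (s m) (f m z))) \<le> R / 8 * (1 / 2) ^ Suc m"
  shows "biholomorphic {z. (\<lambda>n. f n z) \<longlonglongrightarrow> 0} {z. (\<lambda>n. s n z) \<longlonglongrightarrow> 0}"
proof -
  have bij: "bij (f n)" "bij (s n)" for n
    using f s by (auto simp: biholomorphism_def)
  have cancel: "f n (inv (f n) z) = z" "inv (f n) (f n z) = z"
      "s n (inv (s n) z) = z" "inv (s n) (s n z) = z" for n z
    using bij by (simp_all add: bij_is_surj bij_is_inj surj_f_inv_f inv_f_f)
  have hol: "holomorphic_map_on (f n) U" "holomorphic_map_on (inv (f n)) U"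
      "holomorphic_map_on (s n) U" "holomorphic_map_on (inv (s n)) U" for n U
    using f[of n] s[of n] unfolding biholomorphism_def
    by (auto intro: holomorphic_map_on_subset)
  have f_stay: "f m z \<in> ball 0 R" if "f n z \<in> ball 0 R" "n \<le> m" for n m z
    using that(2,1) by (induction rule: dec_induct) (blast intro: f_step)+

  \<comment> \<open>In \<open>h n m\<close> a point is described by its image under
    \<open>f n\<close> and the result by its image under \<open>s n\<close>; \<open>H n\<close> is
    the limit in these coordinates. Convergence behind \<open>\<psi>\<close> is established only at
    points whose \<open>f\<close>-orbit enters \<open>ball 0 R\<close>.\<close>
  define h where "h n m w = s n (inv (s m) (f m (inv (f n) w)))" for n m w
  define \<psi> where "\<psi> z = lim (\<lambda>m. inv (s m) (f m z))" for z
  define H where "H n w = s n (\<psi> (inv (f n) w))" for n w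
  have h_step: "norm (h n (Suc m) w - h n m w) \<le> R / 8 * (1 / 2) ^ Suc m"
    if "n \<le> m" "w \<in> ball 0 R" for n m w
    unfolding h_def using that f_stay[of n "inv (f n) w" m] by (intro close) (auto simp: cancel)
  \<comment> \<open>The factor \<open>1 - (1 / 2) ^ j\<close> is the exact partial sum of the
    geometric series, so that the induction closes.\<close>
  have h_dist: "norm (h n (m + j) w - h n m w) \<le> R / 8 * (1 / 2) ^ m * (1 - (1 / 2) ^ j)"
    if "n \<le> m" "w \<in> ball 0 R" for n m w j
  proof (induction j)
    case (Suc j)
    have "norm (h n (m + Suc j) w - h n m w)
        \<le> norm (h n (Suc (m + j)) w - h n (m + j) w) + norm (h n (m + j) w - h n m w)"
      using norm_triangle_ineq[of "h n (Suc (m + j)) w - h n (m + j) w" "h n (m + j) w - h n m w"]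
      by simp
    also have "\<dots> \<le> R / 8 * (1 / 2) ^ Suc (m + j) + R / 8 * (1 / 2) ^ m * (1 - (1 / 2) ^ j)"
      using that by (intro add_mono Suc h_step) auto
    also have "\<dots> = R / 8 * (1 / 2) ^ m * (1 - (1 / 2) ^ Suc j)"
      by (simp add: power_add field_simps)
    finally show ?case .
  qed simp
  have h_dist': "norm (h n m' w - h n m w) \<le> R / 8 * (1 / 2) ^ m"
    if "n \<le> m" "m \<le> m'" "w \<in> ball 0 R" for n m m' w
  proof -
    have "norm (h n (m + (m' - m)) w - h n m w) \<le> R / 8 * (1 / 2) ^ m * (1 - (1 / 2) ^ (m' - m))"
      by (rule h_dist) fact+
    also have "\<dots> \<le> R / 8 * (1 / 2) ^ m * 1"
      using \<open>R > 0\<close> by (intro mult_left_mono) auto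
    finally show ?thesis using that by simp
  qed
  have small: "\<exists>N\<ge>n. R / 8 * (1 / 2) ^ N < e" if "e > 0" for e n
  proof -
    have "(\<lambda>N. R / 8 * (1 / 2) ^ N) \<longlonglongrightarrow> R / 8 * 0"
      by (intro tendsto_intros LIMSEQ_power_zero) auto
    then have "\<forall>\<^sub>F N in sequentially. R / 8 * (1 / 2) ^ N < e"
      using that by (intro order_tendstoD) auto
    then show ?thesis
      unfolding eventually_sequentially by (metis nle_le)
  qed
  have H_lim: "(\<lambda>m. h n m w) \<longlonglongrightarrow> H n w" if w: "w \<in> ball 0 R" for n w
  proof -
    have "Cauchy (\<lambda>m. h n m w)"
    proof (rule CauchyI')
      fix e :: real assume "e > 0"
      then obtain N where N: "N \<ge> n" "R / 8 * (1 / 2) ^ N < e / 2" using small[of "e / 2" n] by auto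
      have "dist (h n m w) (h n m' w) < e" if "m \<ge> N" "m' \<ge> N" for m m'
        using h_dist'[OF N(1) that(1) w] h_dist'[OF N(1) that(2) w] N(2)
          dist_triangle2[of "h n m w" "h n m' w" "h n N w"] by (simp add: dist_norm)
      then show "\<exists>M. \<forall>m\<ge>M. \<forall>m'>m. dist (h n m w) (h n m' w) < e"
        by (meson le_trans less_imp_le)
    qed
    then obtain L where L: "(\<lambda>m. h n m w) \<longlonglongrightarrow> L"
      using Cauchy_convergent convergent_def by blast
    \<comment> \<open>Continuity of \<open>inv (s n)\<close> transfers convergence of
      \<open>h n m w\<close> to the sequence defining \<open>\<psi>\<close>, which identifies
      \<open>L\<close> with \<open>H n w\<close>.\<close>
    have "isCont (inv (s n)) L"
      using holomorphic_map_on_imp_continuous_on[OF hol(4)[of n UNIV]]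
      by (simp add: continuous_on_eq_continuous_at)
    then have "(\<lambda>m. inv (s n) (h n m w)) \<longlonglongrightarrow> inv (s n) L"
      using L by (rule isCont_tendsto_compose)
    then have "\<psi> (inv (f n) w) = inv (s n) L"
      unfolding \<psi>_def h_def cancel by (rule limI)
    then show ?thesis using L by (simp add: H_def cancel)
  qed
  have H_dist: "norm (h n m w - H n w) \<le> R / 8 * (1 / 2) ^ m"
    if "n \<le> m" "w \<in> ball 0 R" for n m w
  proof (rule tendsto_le[OF trivial_limit_sequentially tendsto_const])
    show "(\<lambda>m'. norm (h n m w - h n m' w)) \<longlonglongrightarrow> norm (h n m w - H n w)"
      by (intro tendsto_intros H_lim that)
    show "\<forall>\<^sub>F m' in sequentially. norm (h n m w - h n m' w) \<le> R / 8 * (1 / 2) ^ m"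
      unfolding eventually_sequentially
      using h_dist'[OF that(1) _ that(2)] by (auto simp: norm_minus_commute)
  qed
  have H_near: "norm (H n w - w) \<le> R / 8" if "w \<in> ball 0 R" for n w
  proof -
    \<comment> \<open>At \<open>m = n\<close> all maps in \<open>h n n\<close> cancel, so
      \<open>h n n w = w\<close>.\<close>
    have "norm (H n w - w) \<le> R / 8 * (1 / 2) ^ n"
      using H_dist[OF order_refl that, of n] by (simp add: h_def cancel norm_minus_commute)
    also have "\<dots> \<le> R / 8 * 1"
      using \<open>R > 0\<close> by (intro mult_left_mono power_le_one) auto
    finally show ?thesis by simp
  qed
  have H_hol: "holomorphic_map_on (H n) (ball 0 R)" for n
  proof (rule holomorphic_map_uniform_limit)
    \<comment> \<open>The index starts at \<open>n\<close> because the estimates hold only for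
      \<open>n \<le> m\<close>.\<close>
    show "holomorphic_map_on (h n (n + j)) (ball 0 R)" for j
    proof -
      have "holomorphic_map_on (s n \<circ> (inv (s (n + j)) \<circ> (f (n + j) \<circ> inv (f n)))) (ball 0 R)"
        using hol by (intro holomorphic_map_on_compose[where V = UNIV]) auto
      then show ?thesis by (simp add: h_def[abs_def] o_def)
    qed
    show "uniform_limit (ball 0 R) (\<lambda>j. h n (n + j)) (H n) sequentially"
    proof (rule uniform_limitI)
      fix e :: real assume "e > 0"
      then obtain N where N: "N \<ge> n" "R / 8 * (1 / 2) ^ N < e" using small by blast
      have "dist (h n (n + j) w) (H n w) < e" if "j \<ge> N" "w \<in> ball 0 R" for j w
      proof -
        have "dist (h n (n + j) w) (H n w) \<le> R / 8 * (1 / 2) ^ (n + j)"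
          unfolding dist_norm using that by (intro H_dist) auto
        also have "\<dots> \<le> R / 8 * (1 / 2) ^ N"
          using that \<open>R > 0\<close> by (intro mult_left_mono power_decreasing) auto
        finally show ?thesis using N by simp
      qed
      then show "\<forall>\<^sub>F j in sequentially. \<forall>w\<in>ball 0 R. dist (h n (n + j) w) (H n w) < e"
        unfolding eventually_sequentially by blast
    qed
  qed
  note H_bih = near_identity_biholomorphism[OF \<open>R > 0\<close> H_hol H_near]

  \<comment> \<open>On \<open>W n\<close> the map \<open>\<psi>\<close> is a composition of three
    biholomorphisms: \<open>f n\<close> onto the half ball, \<open>H n\<close>, and
    \<open>inv (s n)\<close>.\<close>
  define W where "W n = f n -` ball 0 (R / 2)" for n
  have \<psi>_eq: "\<psi> = inv (s n) \<circ> (H n \<circ> f n)" for n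
    by (auto simp: fun_eq_iff H_def cancel)
  have "biholomorphism \<psi> (W n) (\<psi> ` W n)" for n
  proof -
    have fW: "f n ` W n = ball 0 (R / 2)"
      unfolding W_def using bij by (simp add: surj_image_vimage_eq bij_is_surj)
    have "open (W n)"
      unfolding W_def using holomorphic_map_on_imp_continuous_on[OF hol(1)[of n UNIV]]
      by (intro open_vimage) auto
    then have 1: "biholomorphism (f n) (W n) (ball 0 (R / 2))"
      using biholomorphism_restrict[OF f, of "W n" n] fW by simp
    have "open (H n ` ball 0 (R / 2))"
      using H_bih(1)[of n] by (simp add: biholomorphism_def)
    then have 2: "biholomorphism (inv (s n)) (H n ` ball 0 (R / 2)) (inv (s n) ` H n ` ball 0 (R / 2))"
      using biholomorphism_restrict[OF biholomorphism_inv[OF s]] by blast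
    have "biholomorphism \<psi> (W n) (inv (s n) ` H n ` ball 0 (R / 2))"
      unfolding \<psi>_eq[of n]
      using biholomorphism_compose[OF biholomorphism_compose[OF 1 H_bih(1)] 2] .
    then show ?thesis by (metis biholomorphism_def bij_betw_def)
  qed
  moreover have f_basin: "(\<Union>n. W n) = {z. (\<lambda>n. f n z) \<longlonglongrightarrow> 0}"
    and W_ev: "\<And>z. (\<lambda>n. f n z) \<longlonglongrightarrow> 0 \<Longrightarrow> \<forall>\<^sub>F n in sequentially. z \<in> W n"
  proof -
    show ev: "\<forall>\<^sub>F n in sequentially. z \<in> W n" if "(\<lambda>n. f n z) \<longlonglongrightarrow> 0" for z
      unfolding W_def vimage_def mem_Collect_eq
      using that \<open>R > 0\<close> by (intro topological_tendstoD[OF that]) auto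
    have "z \<in> (\<Union>n. W n)" if "(\<lambda>n. f n z) \<longlonglongrightarrow> 0" for z
      using eventually_happens[OF ev[OF that]] by auto
    moreover have "(\<lambda>n. f n z) \<longlonglongrightarrow> 0" if "z \<in> W n" for n z
      using that \<open>R > 0\<close> by (intro f_attr[of n]) (auto simp: W_def)
    ultimately show "(\<Union>n. W n) = {z. (\<lambda>n. f n z) \<longlonglongrightarrow> 0}" by blast
  qed
  \<comment> \<open>Each point of the basin lies in \<open>W n\<close> for all large
    \<open>n\<close>, so two points share one; this is the directedness needed for gluing.\<close>
  have "\<exists>n. x \<in> W n \<and> y \<in> W n" if "x \<in> (\<Union>n. W n)" "y \<in> (\<Union>n. W n)" for x y
    using eventually_happens[OF eventually_conj[OF W_ev[of x] W_ev[of y]]] that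
    unfolding f_basin by auto
  ultimately have "biholomorphism \<psi> (\<Union>n. W n) (\<psi> ` (\<Union>n. W n))"
    by (intro biholomorphism_Union)
  moreover have "\<psi> ` (\<Union>n. W n) = {z. (\<lambda>n. s n z) \<longlonglongrightarrow> 0}"
  proof (intro equalityI subsetI)
    \<comment> \<open>\<open>H n\<close> moves points by at most \<open>R / 8\<close>, so the image
      of the half ball stays inside \<open>ball 0 R\<close>, where \<open>s_attr\<close> takes
      over.\<close>
    fix y assume "y \<in> \<psi> ` (\<Union>n. W n)"
    then obtain n z where z: "z \<in> W n" "y = \<psi> z" by blast
    then have "norm (f n z) < R / 2" by (simp add: W_def)
    then have "s n y \<in> ball 0 R"
      using H_near[of "f n z" n] norm_triangle_ineq[of "H n (f n z) - f n z" "f n z"] \<open>R > 0\<close> z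
      by (simp add: \<psi>_eq[of n] cancel)
    then show "y \<in> {z. (\<lambda>n. s n z) \<longlonglongrightarrow> 0}" using s_attr by blast
  next
    \<comment> \<open>For surjectivity, wait until \<open>s n y\<close> enters
      \<open>ball 0 (R / 8)\<close>, which \<open>H n\<close> covers, and pull the preimage back by
      \<open>f n\<close>.\<close>
    fix y assume "y \<in> {z. (\<lambda>n. s n z) \<longlonglongrightarrow> 0}"
    then have "(\<lambda>n. s n y) \<longlonglongrightarrow> 0" by simp
    then have "\<forall>\<^sub>F n in sequentially. s n y \<in> ball 0 (R / 8)"
      by (rule topological_tendstoD) (use \<open>R > 0\<close> in auto)
    then obtain n where "s n y \<in> ball 0 (R / 8)"
      using eventually_happens[of _ sequentially] by auto
    then obtain w where w: "w \<in> ball 0 (R / 2)" "H n w = s n y" using H_bih(2)[of n] by force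
    have "\<psi> (inv (f n) w) = inv (s n) (H n w)" by (simp add: H_def cancel)
    then have "\<psi> (inv (f n) w) = y" by (simp add: w cancel)
    moreover have "inv (f n) w \<in> W n" using w by (simp add: W_def cancel)
    ultimately show "y \<in> \<psi> ` (\<Union>n. W n)" by blast
  qed
  ultimately show ?thesis
    unfolding biholomorphic_def f_basin by auto
qed

section \<open>Iterates and their perturbations\<close>

lemma iter_comp_biholomorphism:
  assumes "\<And>n. F n \<in> Aut0"
  shows "biholomorphism (iter_comp F n) UNIV UNIV"
proof (induction n)
  case 0
  then show ?case using assms by (simp add: Aut0_def)
next
  case (Suc n)
  then show ?case
    using assms[of "Suc n"] unfolding iter_comp.simps Aut0_def
    by (blast intro: biholomorphism_compose)
qed

text \<open>Each map is uniformly continuous on the compact set, and the minimum of finitely many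
  moduli is positive.\<close>

lemma uniform_modulus_of_finitely_many:
  fixes Q :: "nat \<Rightarrow> 'a :: metric_space \<Rightarrow> 'b :: metric_space"
  assumes "\<And>n. continuous_on K (Q n)" "compact K" "e > 0"
  shows "\<exists>d>0. \<forall>n\<le>m. \<forall>x\<in>K. \<forall>y\<in>K. dist x y < d \<longrightarrow> dist (Q n x) (Q n y) < e"
proof (induction m)
  case 0
  then show ?case
    using compact_uniformly_continuous[OF assms(1)[of 0] assms(2)] \<open>e > 0\<close>
    unfolding uniformly_continuous_on_def by (metis dist_commute le_zero_eq)
next
  case (Suc m)
  then obtain d1 where d1: "d1 > 0"
    "\<forall>n\<le>m. \<forall>x\<in>K. \<forall>y\<in>K. dist x y < d1 \<longrightarrow> dist (Q n x) (Q n y) < e" by blast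
  obtain d2 where d2: "d2 > 0"
    "\<forall>x\<in>K. \<forall>y\<in>K. dist x y < d2 \<longrightarrow> dist (Q (Suc m) x) (Q (Suc m) y) < e"
    using compact_uniformly_continuous[OF assms(1)[of "Suc m"] assms(2)] \<open>e > 0\<close>
    unfolding uniformly_continuous_on_def by (metis dist_commute)
  show ?case
    using d1 d2 by (intro exI[of _ "min d1 d2"]) (auto simp: le_Suc_eq)
qed

text \<open>The bound \<open>(1 - C) * R\<close> compensates the contraction exactly, so the ball
  stays invariant. The bound \<open>C ^ n\<close> lets errors decay at the rate of the contraction
  itself, which costs only a linear factor in the orbit estimate.\<close>

lemma perturbed_contraction_iterates:
  fixes F S :: "nat \<Rightarrow> 'a :: real_normed_vector \<Rightarrow> 'a"
  assumes "0 < C" "C < 1" "R > 0"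
    and S: "\<And>n z. z \<in> ball 0 R \<Longrightarrow> norm (S n z) \<le> C * norm z"
    and F: "\<And>n z. z \<in> ball 0 R \<Longrightarrow> norm (F n z - S n z) < \<delta> n"
    and \<delta>: "\<And>n. \<delta> n \<le> (1 - C) * R" "\<And>n. \<delta> n \<le> C ^ n"
  shows "\<And>n z. iter_comp F n z \<in> ball 0 R \<Longrightarrow> iter_comp F (Suc n) z \<in> ball 0 R"
    and "\<And>n z. iter_comp F n z \<in> ball 0 R \<Longrightarrow> (\<lambda>m. iter_comp F m z) \<longlonglongrightarrow> 0"
proof -
  have F_le: "norm (F n z) < C * norm z + \<delta> n" if "z \<in> ball 0 R" for n z
    using S[OF that, of n] F[OF that, of n] norm_triangle_ineq[of "F n z - S n z" "S n z"] by simp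
  show step: "iter_comp F (Suc n) z \<in> ball 0 R" if "iter_comp F n z \<in> ball 0 R" for n z
  proof -
    have "norm (iter_comp F (Suc n) z) < C * norm (iter_comp F n z) + \<delta> (Suc n)"
      using F_le[OF that] by simp
    also have "\<dots> \<le> C * R + (1 - C) * R"
      using that \<open>0 < C\<close> by (intro add_mono \<delta> mult_left_mono) auto
    finally show ?thesis by (simp add: algebra_simps)
  qed
  fix n z assume n: "iter_comp F n z \<in> ball 0 R"
  define a where "a j = iter_comp F (n + j) z" for j
  have a: "a j \<in> ball 0 R" for j
    by (induction j) (use n step in \<open>auto simp: a_def simp del: iter_comp.simps mem_ball\<close>)
  \<comment> \<open>Each step multiplies by \<open>C\<close> and adds an error of at most
    \<open>C ^ Suc (n + j) \<le> C ^ Suc j\<close>; the errors accumulate to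
    \<open>real j * C ^ j\<close>.\<close>
  have le: "norm (a j) \<le> C ^ j * (norm (a 0) + real j)" for j
  proof (induction j)
    case (Suc j)
    have "norm (a (Suc j)) \<le> C * norm (a j) + C ^ Suc (n + j)"
      using F_le[OF a[of j], of "Suc (n + j)"] \<delta>(2)[of "Suc (n + j)"] by (simp add: a_def)
    also have "\<dots> \<le> C * (C ^ j * (norm (a 0) + real j)) + C ^ Suc j"
      using Suc \<open>0 < C\<close> \<open>C < 1\<close> by (intro add_mono mult_left_mono power_decreasing) auto
    finally show ?case by (simp add: algebra_simps)
  qed simp
  have "(\<lambda>j. C ^ j * norm (a 0) + real j * C ^ j) \<longlonglongrightarrow> 0 * norm (a 0) + 0"
    using powser_times_n_limit_0[of C] \<open>0 < C\<close> \<open>C < 1\<close> by (intro tendsto_intros LIMSEQ_power_zero) auto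
  then have *: "(\<lambda>j. C ^ j * (norm (a 0) + real j)) \<longlonglongrightarrow> 0"
    by (simp add: algebra_simps)
  have "a \<longlonglongrightarrow> 0"
    by (rule Lim_null_comparison[OF _ *]) (use le in simp)
  then have "(\<lambda>m. iter_comp F (m + n) z) \<longlonglongrightarrow> 0"
    by (simp add: a_def[abs_def] add.commute)
  then show "(\<lambda>m. iter_comp F m z) \<longlonglongrightarrow> 0" by (rule LIMSEQ_offset)
qed

section \<open>Choice of the perturbation sizes and conclusion\<close>

theorem theorem1p2:
  fixes S :: "nat \<Rightarrow> complex ^ 'k \<Rightarrow> complex ^ 'k"
  assumes "CARD('k) \<ge> 2"
    and "\<forall>n. S n \<in> Aut0"
    and "uniform_upper_bound S"
  shows "\<exists>(\<delta> :: nat \<Rightarrow> real) (r :: real).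
           (\<forall>n. \<delta> n > 0) \<and> \<delta> \<longlonglongrightarrow> 0 \<and> r > 0 \<and>
           (\<forall>F :: nat \<Rightarrow> complex ^ 'k \<Rightarrow> complex ^ 'k.
              (\<forall>n. F n \<in> Aut0) \<and>
              (\<forall>n. \<forall>z\<in>ball 0 r. norm (F n z - S n z) < \<delta> n)
              \<longrightarrow> biholomorphic (basin F) (basin S))"
proof -
  obtain R C where R: "R > 0" "0 < C" "C < 1"
    and S_le: "\<And>n z. z \<in> ball 0 R \<Longrightarrow> norm (S n z) \<le> C * norm z"
    using assms(3) unfolding uniform_upper_bound_def by blast
  define s where "s = iter_comp S"
  have s: "biholomorphism (s n) UNIV UNIV" for n
    unfolding s_def using assms(2) by (intro iter_comp_biholomorphism) auto
  then have bij: "bij (s n)" for n by (simp add: biholomorphism_def)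
  \<comment> \<open>Only the maps \<open>s n \<circ> inv (s m)\<close> with \<open>n \<le> m\<close>
    occur, finitely many for each \<open>m\<close>, and they depend on \<open>S\<close> alone. Hence
    \<open>d\<close> can be fixed before \<open>F\<close> is given. The compact ball contains
    \<open>ball 0 R\<close>, where the points compared later lie.\<close>
  have "\<exists>d>0. \<forall>n\<le>m. \<forall>x\<in>cball 0 (R + 1). \<forall>y\<in>cball 0 (R + 1). dist x y < d \<longrightarrow>
      dist (s n (inv (s m) x)) (s n (inv (s m) y)) < R / 8 * (1 / 2) ^ m" for m
  proof (rule uniform_modulus_of_finitely_many)
    show "continuous_on (cball 0 (R + 1)) (\<lambda>x. s n (inv (s m) x))" for n
    proof -
      have "holomorphic_map_on (s n \<circ> inv (s m)) UNIV"
        using biholomorphism_compose[OF biholomorphism_inv[OF s] s, of n m]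
        by (simp add: biholomorphism_def)
      then show ?thesis
        using holomorphic_map_on_imp_continuous_on continuous_on_subset by (fastforce simp: o_def)
    qed
  qed (use R in auto)
  then obtain d where d: "\<And>m. d m > 0" "\<And>n m x y. n \<le> m \<Longrightarrow> x \<in> cball 0 (R + 1) \<Longrightarrow>
      y \<in> cball 0 (R + 1) \<Longrightarrow> dist x y < d m \<Longrightarrow>
      dist (s n (inv (s m) x)) (s n (inv (s m) y)) < R / 8 * (1 / 2) ^ m"
    by metis
  \<comment> \<open>The three terms serve in turn the closeness of consecutive approximations, the
    invariance of \<open>ball 0 R\<close>, and the attraction to 0. The last also forces
    \<open>\<delta>\<close> to tend to 0.\<close>
  define \<delta> where "\<delta> m = min (min (d m) ((1 - C) * R)) (C ^ m)" for m
  have \<delta>_pos: "\<delta> m > 0" for m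
    using d(1)[of m] R by (simp add: \<delta>_def)
  have \<delta>_le: "\<delta> m \<le> d m" "\<delta> m \<le> (1 - C) * R" "\<delta> m \<le> C ^ m" for m
    by (auto simp: \<delta>_def)
  have "\<delta> \<longlonglongrightarrow> 0"
  proof (rule tendsto_sandwich[OF _ _ tendsto_const])
    show "(\<lambda>m. C ^ m) \<longlonglongrightarrow> 0" using R by (intro LIMSEQ_power_zero) auto
  qed (use \<delta>_pos \<delta>_le in \<open>auto intro!: always_eventually less_imp_le\<close>)
  moreover have "biholomorphic (basin F) (basin S)"
    if F: "\<And>n. F n \<in> Aut0" and close: "\<And>n z. z \<in> ball 0 R \<Longrightarrow> norm (F n z - S n z) < \<delta> n"
    for F :: "nat \<Rightarrow> complex ^ 'k \<Rightarrow> complex ^ 'k"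
  proof -
    define f where "f = iter_comp F"
    note iter = perturbed_contraction_iterates[where S = S, OF R(2,3,1) S_le _ \<delta>_le(2,3)]
    have F_iter: "f (Suc n) z \<in> ball 0 R" "(\<lambda>m. f m z) \<longlonglongrightarrow> 0" if "f n z \<in> ball 0 R" for n z
      using iter(1,2)[OF _ close, of n z] that unfolding f_def by blast+
    \<comment> \<open>\<open>S\<close> is a perturbation of itself with error 0, so the same lemma
      covers it.\<close>
    have S_iter: "(\<lambda>m. s m z) \<longlonglongrightarrow> 0" if "s n z \<in> ball 0 R" for n z
      using iter(2)[where F = S and n = n and z = z] that \<delta>_pos unfolding s_def by simp
    show ?thesis
      unfolding basin_def f_def[symmetric] s_def[symmetric]
    proof (rule biholomorphic_attracted_sets)
      show "biholomorphism (f n) UNIV UNIV" for n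
        unfolding f_def using F by (rule iter_comp_biholomorphism)
      show "norm (s n (inv (s (Suc m)) (f (Suc m) z)) - s n (inv (s m) (f m z)))
          \<le> R / 8 * (1 / 2) ^ Suc m" if "n \<le> m" and w: "f m z \<in> ball 0 R" for n m z
      proof -
        define w where "w = f m z"
        have F_w: "f (Suc m) z = F (Suc m) w" by (simp add: f_def w_def)
        \<comment> \<open>Rewriting \<open>inv (s m) w\<close> through \<open>S (Suc m) w\<close>
          puts both terms under the single map \<open>s n \<circ> inv (s (Suc m))\<close>. Their
          distance is then governed by the modulus \<open>d (Suc m)\<close> and by how close
          \<open>F (Suc m) w\<close> is to \<open>S (Suc m) w\<close>.\<close>
        have "s (Suc m) (inv (s m) w) = S (Suc m) w"
          using bij[of m] by (simp add: s_def bij_is_surj surj_f_inv_f)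
        then have S_w: "inv (s m) w = inv (s (Suc m)) (S (Suc m) w)"
          using bij[of "Suc m"] by (metis bij_is_inj inv_f_f)
        have "norm (S (Suc m) w) \<le> C * norm w" using S_le w by (simp add: w_def)
        also have "\<dots> \<le> 1 * norm w" using R by (intro mult_right_mono) auto
        finally have "S (Suc m) w \<in> cball 0 (R + 1)" using w by (simp add: w_def)
        moreover have "F (Suc m) w \<in> cball 0 (R + 1)"
          using F_iter(1)[OF w] by (simp add: F_w)
        moreover have "dist (F (Suc m) w) (S (Suc m) w) < d (Suc m)"
          using close[OF w, of "Suc m"] \<delta>_le(1)[of "Suc m"] by (simp add: dist_norm w_def)
        ultimately have "dist (s n (inv (s (Suc m)) (F (Suc m) w))) (s n (inv (s (Suc m)) (S (Suc m) w)))
            < R / 8 * (1 / 2) ^ Suc m"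
          using that by (intro d(2)) auto
        then show ?thesis by (simp add: F_w S_w dist_norm flip: w_def)
      qed
    qed (use R s F_iter S_iter \<delta>_pos in \<open>auto simp del: mem_ball\<close>)
  qed
  ultimately show ?thesis using \<delta>_pos R(1) by (intro exI[of _ \<delta>] exI[of _ R]) auto
qed

end
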